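(* Let $n\ge 1$ and ${\varepsilon}\in\{1,-1\}$. Then $$\sum_{\pi\in S_n} {\varepsilon}^{{\rm inv}(\pi)}\, q^{{\rm maj}(\pi)}\, z^{{\rm last}(\pi)} = \left(\prod_{i=1}^{n-1} [i]_{{\varepsilon}^{i-1} q}\right)\cdot [n]_{{\varepsilon}^{n-1} q/z}\cdot z^{n-1},$$ i.e. it equals $[1]_q[2]_{{\varepsilon} q}[3]_q[4]_{{\varepsilon} q}\cdots[n-1]_{{\varepsilon}^{n-2}q}\cdot [n]_{{\varepsilon}^{n-1}q/z}\, z^{n-1}$.
   Context: $S_n$ is the symmetric group on $\{1,\dots,n\}$, permutations written in one-line notation. ${\rm inv}(\pi)$ is the number of inversions of $\pi$ (equivalently its Coxeter length with respect to the adjacent transpositions); ${\rm maj}(\pi)=\sum\{\,i: \pi(i)>\pi(i+1)\,\}$ is the major index; ${\rm last}(\pi):=\pi(n)-1$. For a positive integer $k$ and an indeterminate expression $t$, $[k]_t := (1-t^k)/(1-t) = 1+t+\cdots+t^{k-1}$. *)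

theory Defs
  imports "HOL-Combinatorics.Permutations"
begin

text \<open>Permutations in \<open>S\<^sub>n\<close> are functions \<open>\<pi>\<close> with \<open>\<pi> permutes {1..n}\<close>; the one-line notation
  is \<open>\<pi> 1, \<dots>, \<pi> n\<close>. The degree \<open>n\<close> is not determined by \<open>\<pi>\<close> and is passed explicitly.\<close>

definition perm_inv :: "nat \<Rightarrow> (nat \<Rightarrow> nat) \<Rightarrow> nat" where
  "perm_inv n \<pi> = card {(i, j). 1 \<le> i \<and> i < j \<and> j \<le> n \<and> \<pi> i > \<pi> j}"

definition perm_maj :: "nat \<Rightarrow> (nat \<Rightarrow> nat) \<Rightarrow> nat" where
  "perm_maj n \<pi> = \<Sum> {i. 1 \<le> i \<and> i < n \<and> \<pi> i > \<pi> (i + 1)}"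

definition perm_last :: "nat \<Rightarrow> (nat \<Rightarrow> nat) \<Rightarrow> nat" where
  "perm_last n \<pi> = \<pi> n - 1"

text \<open>The polynomial form of \<open>(1 - t\<^sup>k) / (1 - t)\<close>, which also makes sense at \<open>t = 1\<close>.
  Identities between such expressions in indeterminates \<open>q\<close>, \<open>z\<close> are stated for arbitrary elements
  \<open>q\<close>, \<open>z \<noteq> 0\<close> of an arbitrary field; the fraction field of \<open>\<int>[q, z]\<close> gives the formal identity.\<close>

definition qint :: "nat \<Rightarrow> 'a::comm_ring_1 \<Rightarrow> 'a" where
  "qint k t = (\<Sum>j<k. t ^ j)"

end

theory Submission
  imports Defs
begin

text \<open>Refine the sum by the last value \<open>k\<close> of the permutation. Deleting the last letter of
  \<open>\<pi> \<in> S\<^sub>n\<close> and standardizing yields \<open>\<sigma> \<in> S\<^bsub>n-1\<^esub>\<close> with \<open>inv \<pi> = inv \<sigma> + (n - k)\<close> and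
  \<open>maj \<pi> = maj \<sigma> + (n - 1)\<close> or \<open>maj \<sigma>\<close>, depending on whether \<open>\<sigma> (n - 1) \<ge> k\<close>. As
  \<open>\<epsilon>\<^bsup>(n-1)(n-2)\<^esup> = 1\<close>, the factor \<open>q\<^bsup>n-1\<^esup>\<close> equals \<open>t\<^bsup>n-1\<^esup>\<close> for \<open>t = \<epsilon>\<^bsup>n-2\<^esup> q\<close>, so that in the
  resulting recursion the two ranges of the last value of \<open>\<sigma>\<close> fit together, up to the factor
  \<open>t\<^bsup>n-k\<^esup>\<close>, to the single geometric sum \<open>[n-1]\<^sub>t\<close>. Hence the part with last value \<open>k\<close> is
  \<open>(\<epsilon>\<^bsup>n-1\<^esup> q)\<^bsup>n-k\<^esup>\<close> times a product independent of \<open>k\<close>.\<close>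

text \<open>Inverse of deleting the last letter and standardizing: values from \<open>k\<close>
  upwards move up by one to make room for \<open>k\<close>. The final branch fixes all other points,
  as \<open>permutes\<close> demands.\<close>

definition append_last :: "nat \<Rightarrow> nat \<Rightarrow> (nat \<Rightarrow> nat) \<Rightarrow> nat \<Rightarrow> nat" where
  "append_last m k \<sigma> i =
    (if i \<in> {1..m} then (if \<sigma> i < k then \<sigma> i else Suc (\<sigma> i)) else if i = Suc m then k else i)"

lemma append_last_less_iff:
  assumes "i \<in> {1..m}" "j \<in> {1..m}"
  shows "append_last m k \<sigma> i < append_last m k \<sigma> j \<longleftrightarrow> \<sigma> i < \<sigma> j"
  using assms by (auto simp: append_last_def)

lemma append_last_Suc [simp]: "append_last m k \<sigma> (Suc m) = k"
  by (simp add: append_last_def)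

lemma less_append_last_iff:
  assumes "i \<in> {1..m}"
  shows "k < append_last m k \<sigma> i \<longleftrightarrow> k \<le> \<sigma> i"
  using assms by (auto simp: append_last_def)

lemma append_last_permutes:
  assumes \<sigma>: "\<sigma> permutes {1..m}" and k: "k \<in> {1..Suc m}"
  shows "append_last m k \<sigma> permutes {1..Suc m}"
proof (rule bij_imp_permutes)
  have range: "\<sigma> i \<in> {1..m}" if "i \<in> {1..m}" for i
    using permutes_in_image[OF \<sigma>] that by blast
  have "append_last m k \<sigma> ` {1..Suc m} \<subseteq> {1..Suc m}"
    using k range by (fastforce simp: append_last_def)
  moreover have "inj_on (append_last m k \<sigma>) {1..Suc m}"
    by (rule inj_onI)
      (auto simp: append_last_def le_Suc_eq split: if_splits dest: injD[OF permutes_inj[OF \<sigma>]])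
  ultimately show "bij_betw (append_last m k \<sigma>) {1..Suc m} {1..Suc m}"
    by (simp add: bij_betw_def endo_inj_surj)
qed (auto simp: append_last_def)

lemma append_last_surj:
  assumes \<pi>: "\<pi> permutes {1..Suc m}" and k: "\<pi> (Suc m) = k"
  shows "\<exists>\<sigma>. \<sigma> permutes {1..m} \<and> append_last m k \<sigma> = \<pi>"
proof -
  \<comment> \<open>Standardization after deleting \<open>k\<close>. The value \<open>k\<close>
    occurs only at \<open>Suc m\<close>, so the second case has \<open>\<pi> i > k\<close> and the
    subtraction does not truncate.\<close>
  define \<sigma> where "\<sigma> i = (if i \<in> {1..m} then (if \<pi> i < k then \<pi> i else \<pi> i - 1) else i)" for i
  have kr: "k \<in> {1..Suc m}"
    using permutes_in_image[OF \<pi>, of "Suc m"] k by simp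
  have range: "\<pi> i \<in> {1..Suc m}" "\<pi> i \<noteq> k" if "i \<in> {1..m}" for i
    using permutes_in_image[OF \<pi>, of i] that k inj_eq[OF permutes_inj[OF \<pi>], of i "Suc m"] by auto
  have "\<sigma> ` {1..m} \<subseteq> {1..m}"
    using kr range by (fastforce simp: \<sigma>_def)
  moreover have "inj_on \<sigma> {1..m}"
  proof (rule inj_onI)
    fix i j assume ij: "i \<in> {1..m}" "j \<in> {1..m}" "\<sigma> i = \<sigma> j"
    then have "\<pi> i = \<pi> j"
      using range[of i] range[of j] by (auto simp: \<sigma>_def split: if_splits)
    then show "i = j"
      using injD[OF permutes_inj[OF \<pi>]] by blast
  qed
  ultimately have "bij_betw \<sigma> {1..m} {1..m}"
    by (simp add: bij_betw_def endo_inj_surj)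
  then have "\<sigma> permutes {1..m}"
    by (rule bij_imp_permutes) (auto simp: \<sigma>_def)
  moreover have "append_last m k \<sigma> i = \<pi> i" for i
    using range[of i] k permutes_not_in[OF \<pi>, of i]
    by (auto simp: append_last_def \<sigma>_def le_Suc_eq)
  ultimately show ?thesis by blast
qed

lemma bij_betw_append_last:
  assumes "k \<in> {1..Suc m}"
  shows "bij_betw (append_last m k) {\<sigma>. \<sigma> permutes {1..m}}
    {\<pi>. \<pi> permutes {1..Suc m} \<and> \<pi> (Suc m) = k}"
  unfolding bij_betw_def
proof
  show "inj_on (append_last m k) {\<sigma>. \<sigma> permutes {1..m}}"
  proof (rule inj_onI, rule ext)
    fix \<sigma> \<tau> i
    assume perms: "\<sigma> \<in> {\<sigma>. \<sigma> permutes {1..m}}" "\<tau> \<in> {\<sigma>. \<sigma> permutes {1..m}}"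
      and eq: "append_last m k \<sigma> = append_last m k \<tau>"
    show "\<sigma> i = \<tau> i"
    proof (cases "i \<in> {1..m}")
      case True
      then show ?thesis
        using fun_cong[OF eq, of i] by (auto simp: append_last_def split: if_splits)
    next
      case False
      then show ?thesis
        using perms by (simp add: permutes_not_in)
    qed
  qed
  show "append_last m k ` {\<sigma>. \<sigma> permutes {1..m}} = {\<pi>. \<pi> permutes {1..Suc m} \<and> \<pi> (Suc m) = k}"
    using append_last_permutes[OF _ assms] append_last_surj by force
qed

text \<open>Old pairs keep their relative order. The new inversions pair \<open>Suc m\<close> with
  the positions whose values lie in \<open>{k..m}\<close>, and \<open>\<sigma>\<close> takes each
  such value once.\<close>

lemma perm_inv_append_last:
  assumes \<sigma>: "\<sigma> permutes {1..m}" and k: "k \<in> {1..Suc m}"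
  shows "perm_inv (Suc m) (append_last m k \<sigma>) = perm_inv m \<sigma> + (Suc m - k)"
proof -
  let ?A = "{(i, j). 1 \<le> i \<and> i < j \<and> j \<le> m \<and> \<sigma> i > \<sigma> j}"
  let ?B = "{i \<in> {1..m}. k \<le> \<sigma> i}"
  have "{(i, j). 1 \<le> i \<and> i < j \<and> j \<le> Suc m \<and> append_last m k \<sigma> i > append_last m k \<sigma> j}
    = ?A \<union> (\<lambda>i. (i, Suc m)) ` ?B"
    by (auto simp: le_Suc_eq append_last_less_iff less_append_last_iff)
  moreover have "finite ?A"
    by (rule finite_subset[of _ "{1..m} \<times> {1..m}"]) auto
  moreover have "card ((\<lambda>i. (i, Suc m)) ` ?B) = card ?B"
    by (intro card_image inj_onI) simp
  moreover have "card ?B = Suc m - k"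
  proof -
    have "\<sigma> ` ?B = {k..m}"
    proof -
      have "\<sigma> ` ?B = \<sigma> ` {1..m} \<inter> {k..}" by auto
      then show ?thesis
        using permutes_image[OF \<sigma>] k by auto
    qed
    then show ?thesis
      using card_image[OF inj_on_subset[OF permutes_inj[OF \<sigma>], of ?B]] by simp
  qed
  moreover have "?A \<inter> (\<lambda>i. (i, Suc m)) ` ?B = {}"
    by auto
  ultimately show ?thesis
    by (simp add: perm_inv_def card_Un_disjoint)
qed

text \<open>The only possible new descent is at position \<open>Suc m\<close>, just before the
  appended letter.\<close>

lemma perm_maj_append_last:
  "perm_maj (Suc (Suc m)) (append_last (Suc m) k \<sigma>)
    = perm_maj (Suc m) \<sigma> + (if k \<le> \<sigma> (Suc m) then Suc m else 0)"
proof -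
  let ?A = "{i. 1 \<le> i \<and> i < Suc m \<and> \<sigma> i > \<sigma> (i + 1)}"
  have "{i. 1 \<le> i \<and> i < Suc (Suc m) \<and>
      append_last (Suc m) k \<sigma> i > append_last (Suc m) k \<sigma> (i + 1)}
    = ?A \<union> (if k \<le> \<sigma> (Suc m) then {Suc m} else {})"
    by (auto simp: less_Suc_eq append_last_less_iff less_append_last_iff)
  then show ?thesis
    by (simp add: perm_maj_def)
qed

text \<open>The power of \<open>z\<close> is constant on such a fibre, so it is left out until the
  end.\<close>

definition inv_maj_sum :: "'a::comm_ring_1 \<Rightarrow> 'a \<Rightarrow> nat \<Rightarrow> nat \<Rightarrow> 'a" where
  "inv_maj_sum \<epsilon> q n k =
    (\<Sum>\<pi> | \<pi> permutes {1..n} \<and> \<pi> n = k. \<epsilon> ^ perm_inv n \<pi> * q ^ perm_maj n \<pi>)"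

lemma sum_permutes_by_last:
  fixes f :: "(nat \<Rightarrow> nat) \<Rightarrow> 'a::comm_monoid_add"
  assumes "1 \<le> n"
  shows "(\<Sum>\<pi> | \<pi> permutes {1..n}. f \<pi>) = (\<Sum>k=1..n. \<Sum>\<pi> | \<pi> permutes {1..n} \<and> \<pi> n = k. f \<pi>)"
proof -
  have "\<pi> n \<in> {1..n}" if "\<pi> permutes {1..n}" for \<pi>
    using permutes_in_image[OF that, of n] assms by simp
  then show ?thesis
    using sum.group[of "{\<pi>. \<pi> permutes {1..n}}" "{1..n}" "\<lambda>\<pi>. \<pi> n" f]
    by (force simp: finite_permutations)
qed

text \<open>The degree is at least two, so that the shortened permutation has a last value
  \<open>l\<close> to compare with \<open>k\<close>.\<close>

lemma inv_maj_sum_Suc: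
  fixes \<epsilon> q :: "'a::comm_ring_1"
  assumes k: "k \<in> {1..Suc (Suc m)}"
  shows "inv_maj_sum \<epsilon> q (Suc (Suc m)) k = \<epsilon> ^ (Suc (Suc m) - k) *
    (\<Sum>l=1..Suc m. inv_maj_sum \<epsilon> q (Suc m) l * (if k \<le> l then q ^ Suc m else 1))"
proof -
  let ?d = "\<epsilon> ^ (Suc (Suc m) - k)"
  have "inv_maj_sum \<epsilon> q (Suc (Suc m)) k = (\<Sum>\<sigma> | \<sigma> permutes {1..Suc m}.
      \<epsilon> ^ perm_inv (Suc (Suc m)) (append_last (Suc m) k \<sigma>) *
      q ^ perm_maj (Suc (Suc m)) (append_last (Suc m) k \<sigma>))"
    unfolding inv_maj_sum_def
    by (rule sum.reindex_bij_betw[OF bij_betw_append_last[OF k], symmetric])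
  also have "\<dots> = (\<Sum>\<sigma> | \<sigma> permutes {1..Suc m}. ?d * (\<epsilon> ^ perm_inv (Suc m) \<sigma> *
      q ^ perm_maj (Suc m) \<sigma> * (if k \<le> \<sigma> (Suc m) then q ^ Suc m else 1)))"
    by (intro sum.cong refl)
      (simp add: perm_inv_append_last[OF _ k] perm_maj_append_last power_add mult_ac del: power_Suc)
  also have "\<dots> = ?d * (\<Sum>l=1..Suc m.
      inv_maj_sum \<epsilon> q (Suc m) l * (if k \<le> l then q ^ Suc m else 1))"
    unfolding sum_distrib_left[symmetric] inv_maj_sum_def sum_distrib_right
    by (subst sum_permutes_by_last) (auto intro!: arg_cong[where f = "(*) ?d"] sum.cong)
  finally show ?thesis .
qed

lemma sum_power_rev:
  fixes t :: "'a::comm_ring_1"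
  shows "(\<Sum>l=1..n. t ^ (n - l)) = qint n t"
  unfolding qint_def
  by (rule sum.reindex_bij_witness[of _ "\<lambda>j. n - j" "\<lambda>l. n - l"]) auto

lemma sum_power_rev_wrap:
  fixes t :: "'a::comm_ring_1"
  assumes "k \<in> {1..Suc n}"
  shows "(\<Sum>l=1..n. t ^ (n - l) * (if k \<le> l then t ^ n else 1)) = t ^ (Suc n - k) * qint n t"
proof -
  \<comment> \<open>The summands are the powers \<open>t\<^sup>j\<close> with \<open>Suc n - k \<le> j < 2 * n + 1 - k\<close>, each once.\<close>
  have "(\<Sum>l=1..n. t ^ (n - l) * (if k \<le> l then t ^ n else 1))
      = (\<Sum>j<n. t ^ (Suc n - k + j))"
    using assms
    \<comment> \<open>Here \<open>j\<close> is the exponent minus \<open>Suc n - k\<close>: the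
      indices \<open>l < k\<close> fill \<open>j < k - 1\<close>, the others fill the rest up to
      \<open>n - 1\<close>.\<close>
    by (intro sum.reindex_bij_witness[of _
          "\<lambda>j. if j < k - 1 then k - 1 - j else n + k - 1 - j"
          "\<lambda>l. if l < k then k - 1 - l else n + k - 1 - l"])
      (auto simp: power_add[symmetric] intro!: arg_cong[where f = "\<lambda>e. t ^ e"])
  then show ?thesis
    by (simp add: qint_def sum_distrib_left power_add)
qed

lemma inv_maj_sum_eq:
  fixes \<epsilon> q :: "'a::comm_ring_1"
  assumes \<epsilon>: "\<epsilon> * \<epsilon> = 1" and k: "k \<in> {1..Suc m}"
  shows "inv_maj_sum \<epsilon> q (Suc m) k =
    (\<Prod>i=1..m. qint i (\<epsilon> ^ (i - 1) * q)) * (\<epsilon> ^ m * q) ^ (Suc m - k)"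
  using k
proof (induction m arbitrary: k)
  case 0
  have "{\<pi>. \<pi> permutes {1..Suc 0} \<and> \<pi> (Suc 0) = k} = {id}"
    using 0 by auto
  moreover have "perm_inv (Suc 0) id = 0"
    by (auto simp: perm_inv_def intro!: arg_cong[where f = card and y = "{}", simplified])
  moreover have "perm_maj (Suc 0) id = 0"
    by (simp add: perm_maj_def)
  ultimately show ?case
    using 0 by (simp add: inv_maj_sum_def del: One_nat_def permutes_sing)
next
  case (Suc m)
  define t where "t = \<epsilon> ^ m * q"
  define P where "P = (\<Prod>i=1..m. qint i (\<epsilon> ^ (i - 1) * q))"
  have "even (m * Suc m)" by simp
  then obtain r where "m * Suc m = 2 * r" by (rule evenE)
  then have "\<epsilon> ^ (m * Suc m) = 1"
    using \<epsilon> by (simp only: power_mult power2_eq_square power_one)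
  then have q: "q ^ Suc m = t ^ Suc m"
    by (simp only: t_def power_mult_distrib power_mult[symmetric] mult_1)
  have "inv_maj_sum \<epsilon> q (Suc (Suc m)) k = \<epsilon> ^ (Suc (Suc m) - k) *
      (\<Sum>l=1..Suc m. P * t ^ (Suc m - l) * (if k \<le> l then t ^ Suc m else 1))"
    unfolding inv_maj_sum_Suc[OF Suc.prems] q
    by (intro arg_cong2[where f = "(*)"] sum.cong refl) (simp add: Suc.IH P_def t_def)
  also have "\<dots> = \<epsilon> ^ (Suc (Suc m) - k) * (P * (t ^ (Suc (Suc m) - k) * qint (Suc m) t))"
    by (simp only: sum_power_rev_wrap[OF Suc.prems, symmetric] sum_distrib_left mult.assoc)
  \<comment> \<open>The inversion factor has the same exponent as the power of \<open>t\<close>, and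
    \<open>\<epsilon> * t\<close> is the base required in the next degree.\<close>
  also have "\<dots> = P * qint (Suc m) t * (\<epsilon> * t) ^ (Suc (Suc m) - k)"
    by (simp add: power_mult_distrib mult_ac)
  finally show ?case
    by (simp add: P_def t_def mult_ac)
qed

theorem theorem3p2:
  fixes n :: nat and \<epsilon> q z :: "'a::field"
  assumes "n \<ge> 1" and "\<epsilon> \<in> {1, -1}" and "z \<noteq> 0"
  shows "(\<Sum>\<pi> | \<pi> permutes {1..n}. \<epsilon> ^ perm_inv n \<pi> * q ^ perm_maj n \<pi> * z ^ perm_last n \<pi>)
    = (\<Prod>i=1..n-1. qint i (\<epsilon> ^ (i - 1) * q)) * qint n (\<epsilon> ^ (n - 1) * q / z) * z ^ (n - 1)"
proof -
  obtain m where n: "n = Suc m"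
    using assms(1) by (cases n) auto
  define P where "P = (\<Prod>i=1..m. qint i (\<epsilon> ^ (i - 1) * q))"
  define t where "t = \<epsilon> ^ m * q"
  have \<epsilon>: "\<epsilon> * \<epsilon> = 1"
    using assms(2) by auto
  have "(\<Sum>\<pi> | \<pi> permutes {1..n}. \<epsilon> ^ perm_inv n \<pi> * q ^ perm_maj n \<pi> * z ^ perm_last n \<pi>)
      = (\<Sum>k=1..n. inv_maj_sum \<epsilon> q n k * z ^ (k - 1))"
    unfolding sum_permutes_by_last[OF assms(1)] inv_maj_sum_def sum_distrib_right
    by (intro sum.cong refl) (simp add: perm_last_def)
  also have "\<dots> = (\<Sum>k=1..n. P * (t / z) ^ (n - k) * z ^ m)"
  proof (intro sum.cong refl)
    fix k assume k: "k \<in> {1..n}"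
    \<comment> \<open>The first factor cancels the denominator of \<open>(t / z) ^ (n - k)\<close>,
      which leaves the weight \<open>z ^ (k - 1)\<close>.\<close>
    then have "z ^ m = z ^ (n - k) * z ^ (k - 1)"
      by (simp add: n power_add[symmetric])
    then show "inv_maj_sum \<epsilon> q n k * z ^ (k - 1) = P * (t / z) ^ (n - k) * z ^ m"
      using inv_maj_sum_eq[OF \<epsilon>, of k m q] k assms(3)
      by (simp add: n P_def t_def power_divide)
  qed
  also have "\<dots> = P * qint n (t / z) * z ^ m"
    by (simp only: sum_power_rev[symmetric] sum_distrib_left sum_distrib_right)
  finally show ?thesis
    by (simp add: n P_def t_def)
qed

end
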